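(* Let $n \geq 1$ be an integer and let $S$ be a rational function with complex coefficients. Then $S$ vanishes after precisely $n$ applications of $\mathfrak{F}$ (that is, $\mathfrak{F}^{(n)}(S) = 0$ and $\mathfrak{F}^{(n-1)}(S) \neq 0$) if and only if $S$ is of the form $$S(x) = \sum_{j=1}^{2^{n}-1} x^{j-1} S_{j,n}(x^{2^{n}}),$$ where $S_{j,n}$, $1 \le j \le 2^n-1$, are rational functions with complex coefficients, $S_{2^{n-1},n} \neq 0$, and the $S_{j,n}$ with $j \neq 2^{n-1}$ are arbitrary.
   Context: Let $\mathfrak{R}$ denote the space of rational functions in $x$ with complex coefficients. For $R \in \mathfrak{R}$ with Laurent expansion $R(x) = \sum_{k \gg -\infty} a_k x^k$ at $x=0$ (the coefficients vanish for all sufficiently negative $k$), the map $\mathfrak{F}: \mathfrak{R} \to \mathfrak{R}$ is defined by $$\mathfrak{F}(R(x)) = \sum_{k \gg -\infty} a_{2k+1} x^k = \frac{R(\sqrt{x}) - R(-\sqrt{x})}{2\sqrt{x}}.$$ $\mathfrak{F}^{(k)}$ denotes the $k$-th iterate of $\mathfrak{F}$, with $\mathfrak{F}^{(0)}$ the identity. *)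

theory Defs
  imports "HOL-Computational_Algebra.Computational_Algebra" "HOL-Computational_Algebra.Field_as_Ring"
begin

unbundle fps_syntax

type_synonym ratfun = "complex poly fract"

definition ratfun_X :: ratfun where
  "ratfun_X = Fract [:0, 1:] 1"

definition laurent_at_0 :: "ratfun \<Rightarrow> complex fls" where
  "laurent_at_0 R =
    (case quot_of_fract R of (p, q) \<Rightarrow> fps_to_fls (fps_of_poly p) / fps_to_fls (fps_of_poly q))"

lemma fps_to_fls_of_poly_eq_0_iff [simp]:
  "fps_to_fls (fps_of_poly p) = 0 \<longleftrightarrow> (p :: complex poly) = 0"
  using fps_of_poly_eq_iff[of p 0] by simp

lemma quot_of_fract_Fract_cross:
  fixes p q :: "complex poly"
  assumes "q \<noteq> 0"
  obtains r s where "quot_of_fract (Fract p q) = (r, s)" "s \<noteq> 0" "r * q = p * s"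
proof -
  obtain r s where rs: "quot_of_fract (Fract p q) = (r, s)" by (cases "quot_of_fract (Fract p q)")
  have s: "s \<noteq> 0" using snd_quot_of_fract_nonzero[of "Fract p q"] rs by simp
  have "Fract r s = Fract p q" using Fract_quot_of_fract[of "Fract p q"] rs by simp
  thus thesis using that rs s assms by (simp add: eq_fract)
qed

lemma laurent_at_0_Fract:
  assumes "q \<noteq> 0"
  shows "laurent_at_0 (Fract p q) = fps_to_fls (fps_of_poly p) / fps_to_fls (fps_of_poly q)"
proof -
  obtain r s where rs: "quot_of_fract (Fract p q) = (r, s)" "s \<noteq> 0" "r * q = p * s"
    using quot_of_fract_Fract_cross[OF assms] .
  have "fps_to_fls (fps_of_poly (r * q)) = fps_to_fls (fps_of_poly (p * s))" by (simp only: rs)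
  hence "fps_to_fls (fps_of_poly r) * fps_to_fls (fps_of_poly q) =
         fps_to_fls (fps_of_poly p) * fps_to_fls (fps_of_poly s)"
    by (simp add: fps_of_poly_mult fls_times_fps_to_fls)
  thus ?thesis using assms rs by (simp add: laurent_at_0_def frac_eq_eq)
qed

lemma laurent_at_0_eq_iff: "laurent_at_0 R = laurent_at_0 T \<longleftrightarrow> R = T"
proof
  assume *: "laurent_at_0 R = laurent_at_0 T"
  obtain p q where R: "R = Fract p q" "q \<noteq> 0" by (cases R) auto
  obtain r s where T: "T = Fract r s" "s \<noteq> 0" by (cases T) auto
  have "fps_to_fls (fps_of_poly p) * fps_to_fls (fps_of_poly s) =
        fps_to_fls (fps_of_poly r) * fps_to_fls (fps_of_poly q)"
    using * R T by (simp add: laurent_at_0_Fract frac_eq_eq)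
  hence "fps_to_fls (fps_of_poly (p * s)) = fps_to_fls (fps_of_poly (r * q))"
    by (simp add: fps_of_poly_mult fls_times_fps_to_fls)
  hence "p * s = r * q" by (simp add: fps_of_poly_eq_iff)
  thus "R = T" using R T by (simp add: eq_fract)
qed simp

text \<open>
  The rational function \<open>R(x\<^sup>m)\<close>, meaningful for \<open>m > 0\<close> only: for \<open>m = 0\<close> the denominator
  may become \<open>0\<close>, in which case \<open>Fract\<close> returns \<open>0\<close>.
\<close>
definition ratfun_compose_power :: "ratfun \<Rightarrow> nat \<Rightarrow> ratfun" where
  "ratfun_compose_power R m =
    (case quot_of_fract R of (p, q) \<Rightarrow> Fract (pcompose p (monom 1 m)) (pcompose q (monom 1 m)))"

lemma pcompose_monom_nonzero:
  "u \<noteq> 0 \<Longrightarrow> m > 0 \<Longrightarrow> pcompose u (monom 1 m) \<noteq> (0 :: complex poly)"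
  using pcompose_eq_0[of u "monom 1 m"] by (auto simp: degree_monom_eq)

lemma ratfun_compose_power_Fract:
  assumes "q \<noteq> 0" "m > 0"
  shows "ratfun_compose_power (Fract p q) m =
    Fract (pcompose p (monom 1 m)) (pcompose q (monom 1 m))"
proof -
  obtain r s where rs: "quot_of_fract (Fract p q) = (r, s)" "s \<noteq> 0" "r * q = p * s"
    using quot_of_fract_Fract_cross[OF assms(1)] .
  have "pcompose (r * q) (monom 1 m) = pcompose (p * s) (monom 1 m)" by (simp only: rs)
  hence "pcompose r (monom 1 m) * pcompose q (monom 1 m) =
         pcompose p (monom 1 m) * pcompose s (monom 1 m)"
    by (simp only: pcompose_mult)
  thus ?thesis using assms rs
    by (simp add: ratfun_compose_power_def eq_fract pcompose_monom_nonzero)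
qed

lemma laurent_at_0_compose_power:
  assumes "m > 0"
  shows "laurent_at_0 (ratfun_compose_power R m) = fls_compose_power (laurent_at_0 R) m"
proof -
  obtain p q where R: "R = Fract p q" "q \<noteq> 0" by (cases R) auto
  have nz: "pcompose q (monom 1 m) \<noteq> 0" using R(2) assms by (rule pcompose_monom_nonzero)
  have c: "ratfun_compose_power R m = Fract (pcompose p (monom 1 m)) (pcompose q (monom 1 m))"
    using R assms by (simp add: ratfun_compose_power_Fract)
  have d: "fps_to_fls (fps_of_poly (pcompose u (monom 1 m))) =
           fls_compose_power (fps_to_fls (fps_of_poly u)) m" for u :: "complex poly"
    using assms by (simp add: fls_compose_power_fps_to_fls fps_of_poly_pcompose fps_of_poly_monom' 
        coeff_monom)
  have "fls_compose_power (fps_to_fls (fps_of_poly q)) m \<noteq> 0"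
    using nz by (simp flip: d)
  moreover have "laurent_at_0 R * fps_to_fls (fps_of_poly q) = fps_to_fls (fps_of_poly p)"
    using R by (simp add: laurent_at_0_Fract)
  hence "fls_compose_power (laurent_at_0 R) m * fls_compose_power (fps_to_fls (fps_of_poly q)) m =
      fls_compose_power (fps_to_fls (fps_of_poly p)) m"
    using assms by (simp flip: fls_compose_power_mult)
  ultimately show ?thesis
    unfolding c laurent_at_0_Fract[OF nz] d by (simp add: field_simps)
qed

text \<open>
  \<open>frakF R\<close> is the rational function with Laurent coefficients \<open>a\<^bsub>2k+1\<^esub>\<close>; the description
  is justified by the existence and uniqueness lemma below.
\<close>
definition frakF :: "ratfun \<Rightarrow> ratfun" where
  "frakF R = (THE T. \<forall>k. laurent_at_0 T $$ k = laurent_at_0 R $$ (2 * k + 1))"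

lemma ex1_frakF: "\<exists>!T. \<forall>k. laurent_at_0 T $$ k = laurent_at_0 R $$ (2 * k + 1)"
proof (rule ex_ex1I)
  fix T U
  assume "\<forall>k. laurent_at_0 T $$ k = laurent_at_0 R $$ (2 * k + 1)"
         "\<forall>k. laurent_at_0 U $$ k = laurent_at_0 R $$ (2 * k + 1)"
  hence "laurent_at_0 T = laurent_at_0 U" by (simp add: fls_eq_iff)
  thus "T = U" by (simp add: laurent_at_0_eq_iff)
next
  \<comment> \<open>Extend \<open>p / q\<close> by \<open>q(-x)\<close>: the denominator becomes a polynomial in \<open>x\<^sup>2\<close>.\<close>
  obtain p q where R: "R = Fract p q" "q \<noteq> 0" by (cases R) auto
  define q' where "q' = pcompose q [:0, -1:]"
  have q'0: "q' \<noteq> 0" using R(2) pcompose_eq_0[of q "[:0, -1:]"] by (auto simp: q'_def)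
  define D where "D = q * q'"
  define N where "N = p * q'"
  have D0: "D \<noteq> 0" using R(2) q'0 by (simp add: D_def)
  have RN: "R = Fract N D" using R q'0 D0 by (simp add: N_def D_def eq_fract)
  have "pcompose q' [:0, -1:] = q"
    by (simp add: q'_def pcompose_pCons flip: pcompose_assoc)
  hence Dsym: "pcompose D [:0, -1:] = D"
    by (simp add: D_def pcompose_mult mult.commute flip: q'_def)
  have Dodd: "coeff D k = 0" if "odd k" for k
  proof -
    have "coeff (pcompose D [:0, -1:]) k = (-1) ^ k * coeff D k" by (rule coeff_pcompose_linear)
    thus ?thesis using Dsym that by simp
  qed
  define E where "E = Abs_poly (\<lambda>k. coeff D (2 * k))"
  define P where "P = Abs_poly (\<lambda>k. coeff N (2 * k + 1))"
  have cE: "coeff E k = coeff D (2 * k)" for k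
    unfolding E_def by (subst coeff_Abs_poly[where n = "degree D"]) (auto intro: coeff_eq_0)
  have cO: "coeff P k = coeff N (2 * k + 1)" for k
    unfolding P_def by (subst coeff_Abs_poly[where n = "degree N"]) (auto intro: coeff_eq_0)
  let ?L = "\<lambda>p :: complex poly. fps_to_fls (fps_of_poly p)"
  have LE: "?L D = fls_compose_power (?L E) 2"
  proof (rule fls_eqI)
    fix k :: int
    show "?L D $$ k = fls_compose_power (?L E) 2 $$ k"
    proof (cases "k < 0")
      case True
      thus ?thesis by (auto simp: fls_nth_compose_power)
    next
      case False
      then obtain m where "k = int m" by (metis nonneg_int_cases not_less)
      thus ?thesis by (cases "even m") (auto simp: fls_nth_compose_power cE Dodd nat_div_distrib)
    qed
  qed
  have E0: "E \<noteq> 0" using D0 LE by auto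
  obtain B where B: "\<forall>n<B. laurent_at_0 R $$ n = 0" by (rule fls_nth_vanishes_belowE)
  define ev od where "ev = Abs_fls (\<lambda>k. laurent_at_0 R $$ (2 * k))"
    and "od = Abs_fls (\<lambda>k. laurent_at_0 R $$ (2 * k + 1))"
  have ev: "ev $$ k = laurent_at_0 R $$ (2 * k)" for k unfolding ev_def
    by (rule nth_Abs_fls_lower_bound[of "min B 0"]) (use B in auto)
  have od: "od $$ k = laurent_at_0 R $$ (2 * k + 1)" for k unfolding od_def
    by (rule nth_Abs_fls_lower_bound[of "min B 0 - 1"]) (use B in auto)
  have split: "laurent_at_0 R = fls_compose_power ev 2 + fls_X * fls_compose_power od 2"
  proof (rule fls_eqI)
    fix k :: int
    show "laurent_at_0 R $$ k = (fls_compose_power ev 2 + fls_X * fls_compose_power od 2) $$ k"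
      by (cases "even k") (auto simp: fls_X_times_conv_shift fls_nth_compose_power ev od elim!: evenE oddE)
  qed
  have "?L N = ?L D * laurent_at_0 R" using D0 by (simp add: RN laurent_at_0_Fract)
  also have "\<dots> = fls_compose_power (?L E * ev) 2 + fls_X * fls_compose_power (?L E * od) 2"
    by (simp add: LE split algebra_simps)
  finally have LN: "?L N = fls_compose_power (?L E * ev) 2 + fls_X * fls_compose_power (?L E * od) 2" .
  have LO: "?L P = ?L E * od"
  proof (rule fls_eqI)
    fix k :: int
    have "(?L E * od) $$ k = ?L N $$ (2 * k + 1)"
      unfolding LN
      by (simp add: fls_X_times_conv_shift fls_nth_compose_power del: fls_compose_power_mult)
    also have "\<dots> = ?L P $$ k" by (auto simp: cO nat_add_distrib nat_mult_distrib)
    finally show "?L P $$ k = (?L E * od) $$ k" ..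
  qed
  have "laurent_at_0 (Fract P E) = od" using E0 by (simp add: laurent_at_0_Fract LO)
  thus "\<exists>T. \<forall>k. laurent_at_0 T $$ k = laurent_at_0 R $$ (2 * k + 1)" using od by metis
qed

lemma laurent_at_0_frakF: "laurent_at_0 (frakF R) $$ k = laurent_at_0 R $$ (2 * k + 1)"
  using theI'[OF ex1_frakF[of R]] by (simp add: frakF_def)

end

theory Submission
  imports Defs
begin

text \<open>
  On Laurent coefficients, \<open>\<FF>\<close> moves the entry at index \<open>2k + 1\<close> to index \<open>k\<close> and drops the
  entries at even indices, so its \<open>n\<close>-th iterate picks out the coefficients whose index is \<open>2\<^sup>n - 1\<close> modulo \<open>2\<^sup>n\<close>
  (\<open>laurent_nth_frakF_iterate\<close>).  Hence \<open>\<FF>\<^sup>n S = 0\<close> says that this one residue class is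
  empty, and then \<open>\<FF>\<^bsup>n-1\<^esup> S\<close>, which sees the classes \<open>2\<^bsup>n-1\<^esup> - 1\<close> and \<open>2\<^sup>n - 1\<close>
  modulo \<open>2\<^sup>n\<close>, is nonzero exactly if the class \<open>2\<^bsup>n-1\<^esup> - 1\<close> is not empty.
  In the sum \<open>\<Sum> x\<^bsup>j-1\<^esup> S\<^sub>j(x\<^sup>N)\<close> with \<open>N = 2\<^sup>n\<close>, the \<open>j\<close>-th summand carries precisely the
  class \<open>j - 1\<close> modulo \<open>N\<close> (\<open>laurent_nth_sum_sections\<close>), the class \<open>N - 1\<close> being left out.

  What remains is that the part of a rational function supported on a residue class comes from
  a rational function again.  The operator itself provides this: multiplying \<open>S\<close> by \<open>x\<^bsup>N - j\<^esup>\<close>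
  moves the class \<open>j - 1\<close> to the class \<open>N - 1\<close>, so \<open>S\<^sub>j = \<FF>\<^sup>n(x\<^bsup>N - j\<^esup> S)\<close> will do.
  Identities between rational functions are checked on Laurent coefficients, since
  \<open>laurent_at_0\<close> is an injective ring homomorphism.
\<close>

lemma laurent_at_0_0 [simp]: "laurent_at_0 0 = 0"
  using laurent_at_0_Fract[of 1 0] by (simp add: Zero_fract_def)

lemma laurent_at_0_1 [simp]: "laurent_at_0 1 = 1"
  using laurent_at_0_Fract[of 1 1] by (simp add: One_fract_def)

lemma laurent_at_0_mult: "laurent_at_0 (R * T) = laurent_at_0 R * laurent_at_0 T"
proof -
  obtain p q where R: "R = Fract p q" "q \<noteq> 0" by (cases R) auto
  obtain r s where T: "T = Fract r s" "s \<noteq> 0" by (cases T) auto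
  show ?thesis using R T
    by (simp add: laurent_at_0_Fract fps_of_poly_mult fls_times_fps_to_fls)
qed

lemma laurent_at_0_add: "laurent_at_0 (R + T) = laurent_at_0 R + laurent_at_0 T"
proof -
  obtain p q where R: "R = Fract p q" "q \<noteq> 0" by (cases R) auto
  obtain r s where T: "T = Fract r s" "s \<noteq> 0" by (cases T) auto
  show ?thesis using R T
    by (simp add: laurent_at_0_Fract fps_of_poly_mult fps_of_poly_add fls_times_fps_to_fls
        add_frac_eq)
qed

lemma laurent_at_0_sum: "laurent_at_0 (sum f A) = (\<Sum>a\<in>A. laurent_at_0 (f a))"
  by (induction A rule: infinite_finite_induct) (simp_all add: laurent_at_0_add)

lemma laurent_at_0_X_power: "laurent_at_0 (ratfun_X ^ m) = fls_X ^ m"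
proof (induction m)
  case (Suc m)
  have "laurent_at_0 ratfun_X = fls_X"
    by (simp add: ratfun_X_def laurent_at_0_Fract fps_of_poly_pCons)
  with Suc show ?case by (simp add: laurent_at_0_mult)
qed simp

lemma laurent_nth_X_power_mult:
  "laurent_at_0 (ratfun_X ^ m * R) $$ k = laurent_at_0 R $$ (k - int m)"
  by (simp add: laurent_at_0_mult laurent_at_0_X_power fls_X_power_times_conv_shift)

lemma ratfun_eq_0_iff_laurent_nth: "R = 0 \<longleftrightarrow> (\<forall>k. laurent_at_0 R $$ k = 0)"
  using laurent_at_0_eq_iff[of R 0] by (simp add: fls_eq_iff)

lemma laurent_nth_frakF_iterate:
  "laurent_at_0 ((frakF ^^ n) R) $$ k = laurent_at_0 R $$ (2 ^ n * k + (2 ^ n - 1))"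
proof (induction n arbitrary: k)
  case (Suc n)
  show ?case by (simp add: laurent_at_0_frakF Suc algebra_simps)
qed simp

text \<open>
  The summand with index \<open>j\<close> meets the exponent \<open>N k + r\<close> only if \<open>r = j - 1\<close>, because both
  \<open>r\<close> and \<open>j - 1\<close> lie below \<open>N\<close>.
\<close>
lemma laurent_nth_sum_sections:
  fixes N r :: nat and k :: int
  assumes "r < N"
  shows "laurent_at_0 (\<Sum>j = 1..N - 1. ratfun_X ^ (j - 1) * ratfun_compose_power (T j) N)
      $$ (int N * k + int r) =
    (if r + 1 < N then laurent_at_0 (T (r + 1)) $$ k else 0)"
proof -
  have N: "N > 0" using assms by simp
  have summand: "laurent_at_0 (ratfun_X ^ (j - 1) * ratfun_compose_power (T j) N)
      $$ (int N * k + int r) = (if j = r + 1 then laurent_at_0 (T (r + 1)) $$ k else 0)"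
    if j: "j \<in> {1..N - 1}" for j
  proof (cases "j = r + 1")
    case True
    thus ?thesis using N
      by (simp add: laurent_nth_X_power_mult laurent_at_0_compose_power fls_nth_compose_power)
  next
    case False
    have "\<not> int N dvd int N * k + int r - int (j - 1)"
    proof
      assume "int N dvd int N * k + int r - int (j - 1)"
      hence "int N dvd int r - int (j - 1)"
        by (metis add_diff_eq dvd_add_times_triv_left_iff mult.commute)
      hence "int r mod int N = int (j - 1) mod int N" by (simp add: mod_eq_dvd_iff)
      thus False using assms j False by auto
    qed
    thus ?thesis using N False
      by (simp add: laurent_nth_X_power_mult laurent_at_0_compose_power fls_nth_compose_power)
  qed
  have "laurent_at_0 (\<Sum>j = 1..N - 1. ratfun_X ^ (j - 1) * ratfun_compose_power (T j) N)
      $$ (int N * k + int r) =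
    (\<Sum>j = 1..N - 1. if j = r + 1 then laurent_at_0 (T (r + 1)) $$ k else 0)"
    unfolding laurent_at_0_sum fls_nth_sum by (rule sum.cong) (use summand in auto)
  also have "\<dots> = (if r + 1 < N then laurent_at_0 (T (r + 1)) $$ k else 0)"
    using assms by (auto simp: sum.delta)
  finally show ?thesis .
qed

theorem theorem2p2:
  fixes n :: nat and S :: ratfun
  assumes "n \<ge> 1"
  shows "((frakF ^^ n) S = 0 \<and> (frakF ^^ (n - 1)) S \<noteq> 0) \<longleftrightarrow>
    (\<exists>Sj :: nat \<Rightarrow> ratfun. Sj (2 ^ (n - 1)) \<noteq> 0 \<and>
      S = (\<Sum>j = 1..2 ^ n - 1. ratfun_X ^ (j - 1) * ratfun_compose_power (Sj j) (2 ^ n)))"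
proof -
  define N M :: nat where "N = 2 ^ n" and "M = 2 ^ (n - 1)"
  have M: "M > 0" by (simp add: M_def)
  have NM: "N = 2 * M" using assms by (simp add: N_def M_def flip: power_Suc)
  hence N: "N > 0" using M by simp
  have Fn: "laurent_at_0 ((frakF ^^ n) R) $$ k = laurent_at_0 R $$ (int N * k + int (N - 1))"
    for R k using N by (simp add: laurent_nth_frakF_iterate N_def of_nat_diff)
  have Fn1: "laurent_at_0 ((frakF ^^ (n - 1)) R) $$ k = laurent_at_0 R $$ (int M * k + int (M - 1))"
    for R k using M by (simp add: laurent_nth_frakF_iterate M_def of_nat_diff)
  define P where "P Sj = (\<Sum>j = 1..N - 1. ratfun_X ^ (j - 1) * ratfun_compose_power (Sj j) N)"
    for Sj
  note nth_P = laurent_nth_sum_sections[of _ N, folded P_def]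
  have "((frakF ^^ n) S = 0 \<and> (frakF ^^ (n - 1)) S \<noteq> 0) \<longleftrightarrow> (\<exists>Sj. Sj M \<noteq> 0 \<and> S = P Sj)"
  proof (intro iffI; elim conjE exE)
    fix Sj assume Sj: "Sj M \<noteq> 0" "S = P Sj"
    have "(frakF ^^ n) S = 0"
      using nth_P[of "N - 1" Sj] N by (simp add: ratfun_eq_0_iff_laurent_nth Fn Sj(2) del: of_nat_diff)
    moreover from Sj(1) obtain k where k: "laurent_at_0 (Sj M) $$ k \<noteq> 0"
      by (auto simp: ratfun_eq_0_iff_laurent_nth)
    have "laurent_at_0 ((frakF ^^ (n - 1)) S) $$ (2 * k) = laurent_at_0 (Sj M) $$ k"
      unfolding Fn1 using nth_P[of "M - 1" Sj k] M by (simp add: Sj(2) NM mult_ac)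
    hence "(frakF ^^ (n - 1)) S \<noteq> 0"
      using k by auto
    ultimately show "(frakF ^^ n) S = 0 \<and> (frakF ^^ (n - 1)) S \<noteq> 0" ..
  next
    assume F: "(frakF ^^ n) S = 0" "(frakF ^^ (n - 1)) S \<noteq> 0"
    (* the power of x moves the class j - 1 modulo N to N - 1, the one that the iterate reads *)
    define Sj where "Sj j = (frakF ^^ n) (ratfun_X ^ (N - j) * S)" for j
    have nth_Sj: "laurent_at_0 (Sj (r + 1)) $$ k = laurent_at_0 S $$ (int N * k + int r)"
      if "r < N" for r k
      using that by (simp add: Sj_def Fn laurent_nth_X_power_mult of_nat_diff)
    have top: "laurent_at_0 S $$ (int N * k + int (N - 1)) = 0" for k
      using F(1) Fn[of S k] by simp
    have "laurent_at_0 S $$ i = laurent_at_0 (P Sj) $$ i" for i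
    proof -
      define k r where "k = i div int N" and "r = nat (i mod int N)"
      have r: "r < N" and i: "i = int N * k + int r"
        using N by (simp_all add: k_def r_def nat_less_iff)
      show ?thesis
        using top[of k] nth_Sj[OF r] nth_P[OF r, of Sj k] r by (cases "r = N - 1") (auto simp: i)
    qed
    hence S: "S = P Sj" by (simp add: fls_eq_iff flip: laurent_at_0_eq_iff)
    have "Sj M \<noteq> 0"
    proof
      assume Sj0: "Sj M = 0"
      (* odd i give the class N - 1 modulo N, even i the class M - 1 *)
      have "laurent_at_0 S $$ (int M * i + int (M - 1)) = 0" for i
      proof (cases "even i")
        case True
        then obtain k where "i = 2 * k" ..
        thus ?thesis using nth_Sj[of "M - 1" k] Sj0 M by (simp add: NM mult_ac)
      next
        case False
        then obtain k where k: "i = 2 * k + 1" ..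
        have "int M * i + int (M - 1) = int N * k + int (N - 1)"
          using M by (simp add: k NM algebra_simps of_nat_diff)
        thus ?thesis using top[of k] by simp
      qed
      thus False using F(2) unfolding ratfun_eq_0_iff_laurent_nth Fn1 by simp
    qed
    with S show "\<exists>Sj. Sj M \<noteq> 0 \<and> S = P Sj" by blast
  qed
  thus ?thesis by (simp add: P_def N_def M_def)
qed

end
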